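(* Let $k\ge1$ and let $\mathcal{L}^N\subset C^\infty(S^1,\mathbb{R})$ be any vector subspace of dimension $N$ with $k\le N\le 2k-2$. Then there exists an equilevel algebra $\mathcal{F}$ of codimension $k$ in $C^\infty(S^1,\mathbb{R})$ such that $\dim(\mathcal{F}\cap\mathcal{L}^N)>N-k$.
   Context: Let $S^1=\mathbb{R}/2\pi\mathbb{Z}$. For $k\ge 1$ let $F(S^1,2k)\subset (S^1)^{2k}$ be the set of sequences $(x_1,\tilde x_1;\dots;x_k,\tilde x_k)$ of $2k$ pairwise distinct points; such a sequence defines the subalgebra $\{f\in C^\infty(S^1,\mathbb{R}): f(x_i)=f(\tilde x_i)\ \forall i\}$. Given an algebraic parametric curve germ $\nu:[0,\varepsilon)\to (S^1)^{2k}$ with $\nu(t)\in F(S^1,2k)$ for $t\in(0,\varepsilon)$, let $\mathcal{F}_t$ be the subalgebra defined by $\nu(t)$, and let $\mathcal{F}_0$ be the set of all $f$ for which there exists a family $f_t$, $t\in[0,\varepsilon)$, continuous in the $C^{2k}$ topology, with $f_0=f$ and $f_t\in\mathcal{F}_t$ for $t>0$. Such subalgebras $\mathcal{F}_0$ are the equilevel algebras of codimension $k$. *)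

theory Defs
  imports "HOL-Analysis.Analysis" "HOL-Library.Function_Algebras"
begin

text \<open>Functions on S^1 = R/2piZ are represented by their 2pi-periodic lifts to the real line.\<close>

definition smooth_fun :: "(real \<Rightarrow> real) \<Rightarrow> bool" where
  "smooth_fun f \<longleftrightarrow> (\<forall>n x. ((deriv ^^ n) f) differentiable (at x))"

definition Cinf_S1 :: "(real \<Rightarrow> real) set" where
  "Cinf_S1 = {f. smooth_fun f \<and> (\<forall>x. f (x + 2 * pi) = f x)}"

definition fscale :: "real \<Rightarrow> (real \<Rightarrow> real) \<Rightarrow> (real \<Rightarrow> real)" where
  "fscale c f = (\<lambda>x. c * f x)"

lemma vector_space_fscale: "vector_space fscale"
  by unfold_locales (auto simp: fscale_def fun_eq_iff algebra_simps)

interpretation fvs: vector_space fscale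
  by (rule vector_space_fscale)

definition same_pt_S1 :: "real \<Rightarrow> real \<Rightarrow> bool" where
  "same_pt_S1 x y \<longleftrightarrow> (x - y) / (2 * pi) \<in> \<int>"

text \<open>A point of (S^1)^{2k} is given by lifts nu 0, ..., nu (2k-1); the pairs are
  (x_i, x~_i) = (nu (2i), nu (2i+1)) for i < k.  Configuration space F(S^1,2k):\<close>
definition in_config :: "nat \<Rightarrow> (nat \<Rightarrow> real) \<Rightarrow> bool" where
  "in_config k p \<longleftrightarrow> (\<forall>i<2*k. \<forall>j<2*k. i \<noteq> j \<longrightarrow> \<not> same_pt_S1 (p i) (p j))"

definition cond_alg :: "nat \<Rightarrow> (nat \<Rightarrow> real) \<Rightarrow> (real \<Rightarrow> real) set" where
  "cond_alg k p = {f \<in> Cinf_S1. \<forall>i<k. f (p (2*i)) = f (p (2*i+1))}"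

text \<open>Algebraic curve germ [0,eps) -> (S^1)^{2k}: each coordinate (lifted to R) is continuous
  on [0,eps) and is a real algebraic function of t there, i.e. satisfies P(t, nu_j(t)) = 0 for a
  nonzero bivariate real polynomial P (represented as a polynomial in y with coefficients in R[t]).\<close>
definition algebraic_germ :: "nat \<Rightarrow> real \<Rightarrow> (real \<Rightarrow> nat \<Rightarrow> real) \<Rightarrow> bool" where
  "algebraic_germ k eps nu \<longleftrightarrow> eps > 0 \<and>
     (\<forall>j<2*k. continuous_on {0..<eps} (\<lambda>t. nu t j) \<and>
        (\<exists>P :: real poly poly. P \<noteq> 0 \<and>
            (\<forall>t\<in>{0..<eps}. poly (map_poly (\<lambda>c. poly c t) P) (nu t j) = 0)))"

definition Cm_continuous_family :: "nat \<Rightarrow> real \<Rightarrow> (real \<Rightarrow> real \<Rightarrow> real) \<Rightarrow> bool" where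
  "Cm_continuous_family m eps fam \<longleftrightarrow>
     (\<forall>t0\<in>{0..<eps}. \<forall>r\<le>m. \<forall>e>0.
        eventually (\<lambda>t. \<forall>x. \<bar>(deriv ^^ r) (fam t) x - (deriv ^^ r) (fam t0) x\<bar> < e)
          (at t0 within {0..<eps}))"

definition limit_alg :: "nat \<Rightarrow> real \<Rightarrow> (real \<Rightarrow> nat \<Rightarrow> real) \<Rightarrow> (real \<Rightarrow> real) set" where
  "limit_alg k eps nu = {f \<in> Cinf_S1. \<exists>fam. fam 0 = f \<and>
      (\<forall>t\<in>{0<..<eps}. fam t \<in> cond_alg k (nu t)) \<and> Cm_continuous_family (2*k) eps fam}"

definition equilevel_algebra :: "nat \<Rightarrow> (real \<Rightarrow> real) set \<Rightarrow> bool" where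
  "equilevel_algebra k F \<longleftrightarrow> (\<exists>eps nu. algebraic_germ k eps nu \<and>
      (\<forall>t\<in>{0<..<eps}. in_config k (nu t)) \<and> F = limit_alg k eps nu)"

end

theory Submission
  imports Defs "HOL-Homology.Invariance_of_Domain"
begin

text \<open>The functionals \<open>f \<mapsto> f (x\<^sub>i) - f (y\<^sub>i)\<close> of \<open>k\<close> chords become linearly dependent on
  \<open>L\<close> for a suitable choice of \<open>2k\<close> distinct points, so the algebra of a single generic chord diagram
  already works, and a constant curve germ suffices. Such chords come from the Hobby--Rice theorem: applied to a basis
  of \<open>L\<close> and the identity, it yields a sign pattern with at most \<open>N + 1\<close> sign changes on the interval, all of
  whose signed increments vanish. For periodic functions this is an alternating sum over an even number, at most
  \<open>N + 2 \<le> 2k\<close>, of points of the circle.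

  The Hobby--Rice theorem follows from the oddness of the degree of certain odd self-maps of spheres. The maps
  of Hobby--Rice type for piecewise affine curves are closed under restriction to the equator and
  under linear changes of the target, and their restrictions to the equator miss some direction. Hence they can be
  deformed to preserve the equator, and the parity of the degree is found by induction on the dimension.\<close>

subsection \<open>Normalised maps into spheres\<close>

lemma topspace_nsphere_eq:
  "topspace (nsphere n) = {x. (\<Sum>i\<le>n. (x i)\<^sup>2) = 1 \<and> (\<forall>i>n. x i = 0)}"
  by (auto simp: nsphere)

text \<open>Radial projection onto the sphere. Coordinates beyond \<open>n\<close> are set to zero
  because points of \<open>nsphere n\<close> are sequences supported on the indices up to
  \<open>n\<close>.\<close>

definition unit_map :: "nat \<Rightarrow> (nat \<Rightarrow> 'a \<Rightarrow> real) \<Rightarrow> 'a \<Rightarrow> nat \<Rightarrow> real" where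
  "unit_map n h x = (\<lambda>i. if i \<le> n then h i x / sqrt (\<Sum>j\<le>n. (h j x)\<^sup>2) else 0)"

lemma sum_squares_pos:
  fixes v :: "nat \<Rightarrow> real"
  assumes "\<exists>j\<le>n. v j \<noteq> 0"
  shows "(\<Sum>j\<le>n. (v j)\<^sup>2) > 0"
  using assms by (auto intro: sum_pos2)

lemma continuous_map_unit_map:
  assumes cont: "\<And>j. j \<le> n \<Longrightarrow> continuous_map X euclideanreal (h j)"
    and nz: "\<And>x. x \<in> topspace X \<Longrightarrow> \<exists>j\<le>n. h j x \<noteq> 0"
  shows "continuous_map X (nsphere n) (unit_map n h)"
proof -
  have pos: "(\<Sum>j\<le>n. (h j x)\<^sup>2) > 0" if "x \<in> topspace X" for x
    using sum_squares_pos[of n "\<lambda>j. h j x"] nz[OF that] by auto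
  have norm: "continuous_map X euclideanreal (\<lambda>x. sqrt (\<Sum>j\<le>n. (h j x)\<^sup>2))"
    using cont by (auto intro!: continuous_intros)
  have comp: "continuous_map X euclideanreal (\<lambda>x. unit_map n h x i)" for i
  proof (cases "i \<le> n")
    case True
    have "continuous_map X euclideanreal (\<lambda>x. h i x / sqrt (\<Sum>j\<le>n. (h j x)\<^sup>2))"
      using pos by (intro continuous_map_real_divide cont True norm) fastforce
    then show ?thesis
      by (simp add: unit_map_def True)
  qed (simp add: unit_map_def)
  have unit: "(\<Sum>i\<le>n. (unit_map n h x i)\<^sup>2) = 1" if "x \<in> topspace X" for x
  proof -
    have "(\<Sum>i\<le>n. (unit_map n h x i)\<^sup>2) = (\<Sum>i\<le>n. (h i x)\<^sup>2 / (\<Sum>j\<le>n. (h j x)\<^sup>2))"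
      using pos[OF that] by (intro sum.cong) (auto simp: unit_map_def power_divide)
    also have "\<dots> = 1"
      using pos[OF that] by (simp flip: sum_divide_distrib)
    finally show ?thesis .
  qed
  show ?thesis
    unfolding nsphere continuous_map_in_subtopology continuous_map_componentwise
    using comp unit by (auto simp: unit_map_def)
qed

text \<open>The straight-line homotopy avoids the origin by \<open>nz\<close>, so normalising it
  gives a homotopy of maps into the sphere.\<close>

lemma Brouwer_degree2_unit_map_homotopic:
  assumes f: "\<And>j. j \<le> n \<Longrightarrow> continuous_map (nsphere n) euclideanreal (f j)"
    and g: "\<And>j. j \<le> n \<Longrightarrow> continuous_map (nsphere n) euclideanreal (g j)"
    and nz: "\<And>x t. x \<in> topspace (nsphere n) \<Longrightarrow> 0 \<le> t \<Longrightarrow> t \<le> 1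
                \<Longrightarrow> \<exists>j\<le>n. (1 - t) * f j x + t * g j x \<noteq> 0"
  shows "Brouwer_degree2 n (unit_map n f) = Brouwer_degree2 n (unit_map n g)"
proof -
  let ?X = "prod_topology (top_of_set {0..1::real}) (nsphere n)"
  define h where "h j = (\<lambda>(t, x). (1 - t) * f j x + t * g j x)" for j
  have fst: "continuous_map ?X euclideanreal fst"
    by (metis continuous_map_fst continuous_map_in_subtopology)
  have "continuous_map ?X euclideanreal (h j)" if "j \<le> n" for j
  proof -
    have "continuous_map ?X euclideanreal (\<lambda>y. f j (snd y))" "continuous_map ?X euclideanreal (\<lambda>y. g j (snd y))"
      using continuous_map_compose[OF continuous_map_snd f[OF that]]
        continuous_map_compose[OF continuous_map_snd g[OF that]] by (auto simp: o_def)
    then have "continuous_map ?X euclideanreal (\<lambda>y. (1 - fst y) * f j (snd y) + fst y * g j (snd y))"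
      using fst by (intro continuous_intros) auto
    then show ?thesis
      by (simp add: h_def case_prod_unfold)
  qed
  moreover have "\<exists>j\<le>n. h j y \<noteq> 0" if "y \<in> topspace ?X" for y
    using that nz by (auto simp: h_def)
  ultimately have cont: "continuous_map ?X (nsphere n) (unit_map n h)"
    by (rule continuous_map_unit_map)
  have "homotopic_with (\<lambda>x. True) (nsphere n) (nsphere n) (unit_map n f) (unit_map n g)"
    unfolding homotopic_with_def
    by (rule exI[of _ "unit_map n h"]) (use cont in \<open>auto simp: unit_map_def h_def fun_eq_iff\<close>)
  then show ?thesis
    by (rule Brouwer_degree2_homotopic)
qed

subsection \<open>Maps of Hobby--Rice type\<close>

text \<open>A point \<open>x\<close> of the sphere encodes a division of the unit interval into consecutive
  intervals of lengths \<open>(x i)\<^sup>2\<close>, the \<open>i\<close>-th one carrying the sign of \<open>x i\<close>.\<close>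

definition psq :: "(nat \<Rightarrow> real) \<Rightarrow> nat \<Rightarrow> real" where
  "psq x i = (\<Sum>l<i. (x l)\<^sup>2)"

text \<open>The Stieltjes integral against \<open>g\<close> of the sign pattern encoded by
  \<open>x\<close>. Here \<open>g\<close> plays the part of a primitive of the integrand in the
  usual form of the Hobby--Rice theorem, so that point evaluations of \<open>g\<close>
  appear.\<close>

definition signed_incr :: "(real \<Rightarrow> real) \<Rightarrow> nat \<Rightarrow> (nat \<Rightarrow> real) \<Rightarrow> real" where
  "signed_incr g n x = (\<Sum>i\<le>n. sgn (x i) * (g (psq x (Suc i)) - g (psq x i)))"

lemma psq_uminus [simp]: "psq (\<lambda>i. - x i) = psq x"
  by (simp add: psq_def fun_eq_iff)

lemma signed_incr_uminus: "signed_incr g n (\<lambda>i. - x i) = - signed_incr g n x"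
  by (simp add: signed_incr_def sgn_minus flip: sum_negf)

lemma signed_incr_diff_scale:
  "signed_incr (\<lambda>t. g t - c * h t) n x = signed_incr g n x - c * signed_incr h n x"
  by (simp add: signed_incr_def sum_distrib_left algebra_simps flip: sum_subtractf)

lemma signed_incr_zero [simp]: "signed_incr (\<lambda>t. 0) n x = 0"
  by (simp add: signed_incr_def)

lemma signed_incr_Suc_equator:
  "x (Suc n) = 0 \<Longrightarrow> signed_incr g (Suc n) x = signed_incr g n x"
  by (simp add: signed_incr_def)

lemma psq_bounds:
  assumes "x \<in> topspace (nsphere n)" "i \<le> Suc n"
  shows "psq x i \<in> {0..1}"
proof -
  have "psq x i \<le> (\<Sum>l\<le>n. (x l)\<^sup>2)"
    unfolding psq_def using assms(2) by (intro sum_mono2) auto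
  then show ?thesis
    using assms(1) by (auto simp: topspace_nsphere_eq psq_def intro: sum_nonneg)
qed

lemma psq_Suc_nsphere: "x \<in> topspace (nsphere n) \<Longrightarrow> psq x (Suc n) = 1"
  by (simp add: topspace_nsphere_eq psq_def lessThan_Suc_atMost)

lemma continuous_map_psq: "continuous_map (nsphere n) euclideanreal (\<lambda>x. psq x i)"
  unfolding psq_def by (intro continuous_intros continuous_map_nsphere_projection) auto

text \<open>\<open>sgn\<close> jumps only at \<open>b = 0\<close>, where the increment it multiplies
  vanishes. The formulas on the two closed half-planes therefore agree on the common
  boundary.\<close>

lemma continuous_on_signed_step:
  fixes g :: "real \<Rightarrow> real"
  assumes "continuous_on UNIV g"
  shows "continuous_on UNIV (\<lambda>(a, b). sgn b * (g (a + b\<^sup>2) - g a))"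
proof -
  let ?G = "\<lambda>y::real \<times> real. g (fst y + (snd y)\<^sup>2) - g (fst y)"
  have "continuous_on ({y. 0 \<le> snd y} \<union> {y. snd y \<le> 0})
      (\<lambda>y::real \<times> real. if 0 \<le> snd y then ?G y else - ?G y)"
    by (intro continuous_on_cases closed_Collect_le continuous_intros continuous_on_compose2[OF assms]) auto
  moreover have "{y. 0 \<le> snd y} \<union> {y. snd y \<le> 0} = (UNIV :: (real \<times> real) set)"
    by auto
  moreover have "(if 0 \<le> snd y then ?G y else - ?G y) = (\<lambda>(a, b). sgn b * (g (a + b\<^sup>2) - g a)) y" for y
    by (auto simp: sgn_if case_prod_unfold)
  ultimately show ?thesis
    by simp
qed

lemma continuous_map_signed_incr:
  assumes "continuous_on UNIV g"
  shows "continuous_map (nsphere n) euclideanreal (signed_incr g n)"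
proof -
  have "continuous_map (nsphere n) euclideanreal (\<lambda>x. sgn (x i) * (g (psq x (Suc i)) - g (psq x i)))" for i
  proof -
    have "continuous_map (nsphere n) (prod_topology euclideanreal euclideanreal) (\<lambda>x. (psq x i, x i))"
      unfolding continuous_map_pairwise
      by (simp add: o_def continuous_map_psq continuous_map_nsphere_projection)
    then have "continuous_map (nsphere n) euclidean (\<lambda>x. (psq x i, x i))"
      by simp
    from continuous_map_compose[OF this, of euclideanreal "\<lambda>(a, b). sgn b * (g (a + b\<^sup>2) - g a)"]
    show ?thesis
      using continuous_on_signed_step[OF assms] by (simp add: o_def psq_def)
  qed
  then show ?thesis
    unfolding signed_incr_def by (intro continuous_map_sum) auto
qed

subsection \<open>Piecewise affine curves\<close>

text \<open>Gaussian elimination: an equation \<open>r\<close> that involves the unknown of index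
  \<open>Suc m\<close> eliminates it from the others, leaving at most \<open>m\<close> equations in
  \<open>m + 1\<close> unknowns.\<close>

lemma homogeneous_system_nontrivial_solution:
  fixes S :: "(nat \<Rightarrow> real) set"
  assumes "finite S" "card S \<le> m"
  shows "\<exists>c. (\<exists>j\<le>m. c j \<noteq> 0) \<and> (\<forall>v\<in>S. (\<Sum>j\<le>m. c j * v j) = 0)"
  using assms
proof (induction m arbitrary: S)
  case 0
  then show ?case
    by (auto intro!: exI[of _ "\<lambda>_. 1"])
next
  case (Suc m)
  show ?case
  proof (cases "\<forall>v\<in>S. v (Suc m) = 0")
    case True
    then show ?thesis
      by (auto intro!: exI[of _ "\<lambda>j. if j = Suc m then 1 else 0"])
  next
    case False
    then obtain r where r: "r \<in> S" "r (Suc m) \<noteq> 0"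
      by blast
    define elim where "elim v = (\<lambda>j. v j - v (Suc m) / r (Suc m) * r j)" for v
    have "card (elim ` (S - {r})) \<le> card (S - {r})"
      using Suc.prems by (intro card_image_le) simp
    also have "\<dots> \<le> m"
      using Suc.prems r by simp
    finally have "card (elim ` (S - {r})) \<le> m" .
    then obtain c where c: "\<exists>j\<le>m. c j \<noteq> 0" "\<And>v. v \<in> S - {r} \<Longrightarrow> (\<Sum>j\<le>m. c j * elim v j) = 0"
      using Suc.IH[of "elim ` (S - {r})"] Suc.prems by auto
    \<comment> \<open>The last entry is forced by the equation of \<open>r\<close>; with it, every
      other equation \<open>v\<close> turns into that of \<open>elim v\<close>.\<close>
    define d where "d j = (if j \<le> m then c j else - (\<Sum>j\<le>m. c j * r j) / r (Suc m))" for j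
    have d: "(\<Sum>j\<le>Suc m. d j * v j) = (\<Sum>j\<le>m. c j * v j) - (\<Sum>j\<le>m. c j * r j) / r (Suc m) * v (Suc m)" for v
      by (simp add: d_def)
    have "(\<Sum>j\<le>Suc m. d j * v j) = 0" if "v \<in> S" for v
    proof (cases "v = r")
      case True
      then show ?thesis using r by (simp only: d) simp
    next
      case False
      then have "(\<Sum>j\<le>m. c j * elim v j) = 0"
        using c(2) that by blast
      then show ?thesis
        by (simp only: d) (simp add: elim_def algebra_simps sum_subtractf sum_distrib_left sum_divide_distrib)
    qed
    moreover have "\<exists>j\<le>Suc m. d j \<noteq> 0"
      using c(1) by (auto simp: d_def intro: le_SucI)
    ultimately show ?thesis by blast
  qed
qed

text \<open>What is recorded is a finite list of affine formulas shared by all coordinates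
  \<open>j\<close>, not the position of the pieces: the general position argument below counts
  choices of formulas.\<close>

definition piecewise_affine :: "(nat \<Rightarrow> real \<Rightarrow> real) \<Rightarrow> bool" where
  "piecewise_affine F \<longleftrightarrow>
     (\<exists>A. finite A \<and> (\<forall>t\<in>{0..1}. \<exists>(a, b)\<in>A. \<forall>j. F j t = a j + b j * t))"

lemma piecewise_affine_shear:
  assumes "piecewise_affine F"
  shows "piecewise_affine (\<lambda>j t. F j t - p j * F m t)"
proof -
  obtain A where A: "finite A" "\<And>t. t \<in> {0..1} \<Longrightarrow> \<exists>(a, b)\<in>A. \<forall>j. F j t = a j + b j * t"
    using assms by (auto simp: piecewise_affine_def)
  define A' where "A' = (\<lambda>(a, b). (\<lambda>j. a j - p j * a m, \<lambda>j. b j - p j * b m)) ` A"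
  have "\<exists>(a, b)\<in>A'. \<forall>j. F j t - p j * F m t = a j + b j * t" if t: "t \<in> {0..1}" for t
  proof -
    obtain a b where ab: "(a, b) \<in> A" "\<forall>j. F j t = a j + b j * t"
      using A(2)[OF t] by auto
    then have "((\<lambda>j. a j - p j * a m), (\<lambda>j. b j - p j * b m)) \<in> A'"
      by (force simp: A'_def)
    then show ?thesis
      by (rule bexI[rotated]) (simp add: ab(2) algebra_simps)
  qed
  moreover have "finite A'"
    using A(1) by (simp add: A'_def)
  ultimately show ?thesis
    unfolding piecewise_affine_def by blast
qed

text \<open>Once the signs and the affine pieces containing the division points are fixed, the vector of
  signed increments depends affinely on \<open>n\<close> parameters, so it lies in an \<open>(n+1)\<close>-dimensional subspace of
  the \<open>(n+2)\<close>-dimensional target. There are finitely many such subspaces, and a generic point of the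
  moment curve lies on none of them.\<close>

lemma signed_incr_generic_direction:
  assumes "piecewise_affine F"
  obtains t :: real where "t \<noteq> 0"
    "\<And>x r. x \<in> topspace (nsphere n) \<Longrightarrow> \<forall>j\<le>Suc n. signed_incr (F j) n x = r * t ^ j \<Longrightarrow> r = 0"
proof -
  obtain A where A: "finite A" "\<And>t. t \<in> {0..1} \<Longrightarrow> \<exists>(a, b)\<in>A. \<forall>j. F j t = a j + b j * t"
    using assms by (auto simp: piecewise_affine_def)
  \<comment> \<open>An element of \<open>D\<close> fixes an affine formula at each division point
    \<open>psq x 0\<close>, ..., \<open>psq x (Suc n)\<close> and a sign on each of the
    \<open>n + 1\<close> intervals.\<close>
  define D where "D = ({..Suc n} \<rightarrow>\<^sub>E A) \<times> ({..n} \<rightarrow>\<^sub>E {-1, 0, 1::real})"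
  \<comment> \<open>The constant part of the vector of signed increments: the first division point
    is 0 and contributes no slope, the last is 1 and contributes its full slope. The
    \<open>n\<close> inner division points are the parameters, each adding a multiple of
    \<open>snd (fst d i)\<close>.\<close>
  define W where "W d j = (\<Sum>i\<le>n. snd d i * (fst (fst d (Suc i)) j - fst (fst d i) j))
      + snd d n * snd (fst d (Suc n)) j" for d :: "(nat \<Rightarrow> (nat \<Rightarrow> real) \<times> (nat \<Rightarrow> real)) \<times> (nat \<Rightarrow> real)" and j
  have "\<exists>c. (\<exists>j\<le>Suc n. c j \<noteq> 0) \<and> (\<Sum>j\<le>Suc n. c j * W d j) = 0 \<and>
      (\<forall>i\<in>{1..n}. (\<Sum>j\<le>Suc n. c j * snd (fst d i) j) = 0)" for d
  proof -
    have "card (insert (W d) ((\<lambda>i. snd (fst d i)) ` {1..n})) \<le> Suc (card ((\<lambda>i. snd (fst d i)) ` {1..n}))"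
      by (rule card_insert_le_m1) auto
    also have "\<dots> \<le> Suc n"
      using card_image_le[of "{1..n}" "\<lambda>i. snd (fst d i)"] by simp
    finally show ?thesis
      using homogeneous_system_nontrivial_solution[of "insert (W d) ((\<lambda>i. snd (fst d i)) ` {1..n})" "Suc n"] by auto
  qed
  then obtain c where c: "\<And>d. \<exists>j\<le>Suc n. c d j \<noteq> 0" "\<And>d. (\<Sum>j\<le>Suc n. c d j * W d j) = 0"
      "\<And>d i. i \<in> {1..n} \<Longrightarrow> (\<Sum>j\<le>Suc n. c d j * snd (fst d i) j) = 0"
    by metis
  \<comment> \<open>\<open>c d\<close> is a nonzero functional vanishing on the subspace of
    \<open>d\<close>, so the moment curve meets its kernel at finitely many parameters. Inserting 0
    ensures \<open>t \<noteq> 0\<close>.\<close>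
  define T where "T = insert 0 (\<Union>d\<in>D. {t. (\<Sum>j\<le>Suc n. c d j * t ^ j) = 0})"
  have "finite D"
    unfolding D_def using A(1) by (intro finite_cartesian_product finite_PiE) auto
  then have "finite T"
    unfolding T_def using c(1) by (auto simp only: finite_insert polyfun_finite_roots intro!: finite_UN_I)
  then obtain t where t: "t \<notin> T"
    using ex_new_if_finite infinite_UNIV_char_0 by blast
  have "r = 0" if x: "x \<in> topspace (nsphere n)" and r: "\<forall>j\<le>Suc n. signed_incr (F j) n x = r * t ^ j" for x r
  proof -
    have "\<exists>ab. ab \<in> A \<and> (\<forall>j. F j (psq x i) = fst ab j + snd ab j * psq x i)" if "i \<le> Suc n" for i
      using A(2)[OF psq_bounds[OF x that]] by force
    then obtain l where l: "\<And>i. i \<le> Suc n \<Longrightarrow> l i \<in> A"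
        "\<And>i j. i \<le> Suc n \<Longrightarrow> F j (psq x i) = fst (l i) j + snd (l i) j * psq x i"
      by metis
    define d where "d = (restrict l {..Suc n}, restrict (\<lambda>i. sgn (x i)) {..n})"
    have "d \<in> D"
      using l(1) by (auto simp: d_def D_def sgn_if)
    define dot where "dot v = (\<Sum>j\<le>Suc n. c d j * v j)" for v
    \<comment> \<open>At \<open>i = 0\<close> the factor \<open>psq x 0\<close> vanishes; at inner
      points \<open>c d\<close> annihilates the slope.\<close>
    have dot_b: "dot (snd (l i)) * psq x i = 0" if "i \<le> n" for i
    proof (cases "i = 0")
      case False
      then show ?thesis
        using c(3)[of i d] that by (simp add: dot_def d_def)
    qed (simp add: psq_def)
    have dot_F: "dot (\<lambda>j. F j (psq x i)) = dot (fst (l i)) + dot (snd (l i)) * psq x i" if "i \<le> Suc n" for i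
      by (simp only: dot_def l(2)[OF that]) (simp add: algebra_simps sum.distrib sum_distrib_left)
    have "dot (\<lambda>j. signed_incr (F j) n x) = (\<Sum>i\<le>n. sgn (x i) * (dot (\<lambda>j. F j (psq x (Suc i))) - dot (\<lambda>j. F j (psq x i))))"
      unfolding dot_def signed_incr_def sum_distrib_left sum_subtractf[symmetric]
      by (subst sum.swap) (simp add: algebra_simps)
    also have "\<dots> = (\<Sum>i\<le>n. sgn (x i) * (dot (fst (l (Suc i))) - dot (fst (l i)))
        + (if i = n then sgn (x n) * dot (snd (l (Suc n))) else 0))"
    proof (intro sum.cong refl)
      fix i assume i: "i \<in> {..n}"
      have "dot (snd (l (Suc i))) * psq x (Suc i) = (if i = n then dot (snd (l (Suc n))) else 0)"
        using dot_b[of "Suc i"] psq_Suc_nsphere[OF x] i by auto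
      then show "sgn (x i) * (dot (\<lambda>j. F j (psq x (Suc i))) - dot (\<lambda>j. F j (psq x i))) =
          sgn (x i) * (dot (fst (l (Suc i))) - dot (fst (l i))) + (if i = n then sgn (x n) * dot (snd (l (Suc n))) else 0)"
        using dot_b[of i] i by (auto simp: dot_F algebra_simps)
    qed
    also have "\<dots> = (\<Sum>i\<le>n. sgn (x i) * (dot (fst (l (Suc i))) - dot (fst (l i)))) + sgn (x n) * dot (snd (l (Suc n)))"
      by (simp add: sum.distrib)
    also have "\<dots> = dot (W d)"
    proof -
      have "W d = (\<lambda>j. (\<Sum>i\<le>n. sgn (x i) * (fst (l (Suc i)) j - fst (l i) j)) + sgn (x n) * snd (l (Suc n)) j)"
        by (simp add: W_def d_def fun_eq_iff)
      then have "dot (W d) = (\<Sum>j\<le>Suc n. \<Sum>i\<le>n. c d j * (sgn (x i) * (fst (l (Suc i)) j - fst (l i) j)))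
          + (\<Sum>j\<le>Suc n. c d j * (sgn (x n) * snd (l (Suc n)) j))"
        by (simp only: dot_def distrib_left sum.distrib sum_distrib_left)
      moreover have "(\<Sum>j\<le>Suc n. \<Sum>i\<le>n. c d j * (sgn (x i) * (fst (l (Suc i)) j - fst (l i) j)))
          = (\<Sum>i\<le>n. sgn (x i) * (dot (fst (l (Suc i))) - dot (fst (l i))))"
        unfolding dot_def sum_distrib_left sum_subtractf[symmetric]
        by (subst sum.swap) (simp only: algebra_simps)
      moreover have "(\<Sum>j\<le>Suc n. c d j * (sgn (x n) * snd (l (Suc n)) j)) = sgn (x n) * dot (snd (l (Suc n)))"
        by (simp only: dot_def sum_distrib_left mult.left_commute)
      ultimately show ?thesis by simp
    qed
    also have "\<dots> = 0"
      using c(2) by (simp only: dot_def)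
    finally have "dot (\<lambda>j. signed_incr (F j) n x) = 0" .
    moreover have "dot (\<lambda>j. signed_incr (F j) n x) = r * (\<Sum>j\<le>Suc n. c d j * t ^ j)"
      unfolding dot_def sum_distrib_left using r by (intro sum.cong) auto
    ultimately show "r = 0"
      using t \<open>d \<in> D\<close> by (auto simp: T_def)
  qed
  then show thesis
    using t that by (auto simp: T_def)
qed

lemma nsphere_0_coordinates:
  assumes "x \<in> topspace (nsphere 0)"
  shows "x 0 = 1 \<or> x 0 = - 1" "i \<noteq> 0 \<Longrightarrow> x i = 0"
  using assms by (auto simp: topspace_nsphere_eq power2_eq_1_iff)

lemma odd_degree_signed_incr:
  assumes "piecewise_affine F" "\<And>j. continuous_on UNIV (F j)"
    and "\<And>x. x \<in> topspace (nsphere n) \<Longrightarrow> \<exists>j\<le>n. signed_incr (F j) n x \<noteq> 0"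
  shows "odd (Brouwer_degree2 n (unit_map n (\<lambda>j. signed_incr (F j) n)))"
  using assms
proof (induction n arbitrary: F)
  case 0
  define e :: "nat \<Rightarrow> real" where "e = (\<lambda>i. if i = 0 then 1 else 0)"
  define f where "f = unit_map 0 (\<lambda>j. signed_incr (F j) 0)"
  have val: "f x = (\<lambda>i. if i = 0 then sgn (x 0) * sgn (F 0 1 - F 0 0) else 0)" if "x \<in> topspace (nsphere 0)" for x
    using nsphere_0_coordinates[OF that]
    by (auto simp: f_def unit_map_def signed_incr_def psq_def fun_eq_iff sgn_if divide_eq_minus_1_iff)
  have "F 0 1 - F 0 0 \<noteq> 0"
    using "0.prems"(3)[of e] by (auto simp: e_def topspace_nsphere_eq signed_incr_def psq_def)
  then consider "sgn (F 0 1 - F 0 0) = 1" | "sgn (F 0 1 - F 0 0) = -1"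
    by (meson sgn_if)
  then have "Brouwer_degree2 0 f \<in> {1, -1}"
  proof cases
    case 1
    have "Brouwer_degree2 0 f = Brouwer_degree2 0 id"
      using nsphere_0_coordinates by (intro Brouwer_degree2_eq) (fastforce simp: val 1 fun_eq_iff)
    then show ?thesis by simp
  next
    case 2
    \<comment> \<open>On the two-point sphere, swapping the points is the reflection in coordinate
      0, of degree -1.\<close>
    have "Brouwer_degree2 0 f = Brouwer_degree2 0 (\<lambda>x i. if i = 0 then - x i else x i)"
      using nsphere_0_coordinates by (intro Brouwer_degree2_eq) (fastforce simp: val 2 fun_eq_iff)
    then show ?thesis by (simp add: Brouwer_degree2_reflection)
  qed
  then show ?case
    by (auto simp: f_def)
next
  case (Suc n)
  let ?H = "\<lambda>F j. signed_incr (F j) (Suc n)"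
  obtain t where "t \<noteq> 0" and t: "\<And>x r. x \<in> topspace (nsphere n) \<Longrightarrow>
      \<forall>j\<le>Suc n. signed_incr (F j) n x = r * t ^ j \<Longrightarrow> r = 0"
    using signed_incr_generic_direction[OF Suc.prems(1), of n] by blast
  \<comment> \<open>The generic direction, scaled to have last entry 1. Subtracting
    \<open>p j\<close> times the last coordinate projects the target along it, and by the choice of
    \<open>t\<close> this kills no nonzero vector of signed increments on the equator.\<close>
  define p where "p j = t ^ j / t ^ Suc n" for j
  define F' where "F' = (\<lambda>j s. F j s - p j * F (Suc n) s)"
  \<comment> \<open>The factor \<open>\<bar>x (Suc n)\<bar>\<close> makes the last coordinate vanish
    on the equator, so that the normalised map preserves it; being even, the factor keeps
    \<open>G\<close> odd.\<close>
  define G where "G j x = (if j \<le> n then ?H F' j x else \<bar>x (Suc n)\<bar> * ?H F (Suc n) x)" for j x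
  have cont': "continuous_on UNIV (F' j)" for j
    unfolding F'_def by (intro continuous_intros Suc.prems(2))
  have contG: "continuous_map (nsphere (Suc n)) euclideanreal (G j)" for j
    unfolding G_def using Suc.prems(2) cont'
    by (cases "j \<le> n") (auto intro!: continuous_intros continuous_map_signed_incr continuous_map_nsphere_projection)
  have H': "?H F' j x = ?H F j x - p j * ?H F (Suc n) x" for j x
    by (simp add: F'_def signed_incr_diff_scale)
  have nz: "\<exists>j\<le>Suc n. (1 - s) * ?H F j x + s * G j x \<noteq> 0"
    if x: "x \<in> topspace (nsphere (Suc n))" and s: "0 \<le> s" "s \<le> 1" for x s
  proof (rule ccontr)
    assume "\<not> ?thesis"
    then have zero: "(1 - s) * ?H F j x + s * G j x = 0" if "j \<le> Suc n" for j
      using that by blast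
    have low: "?H F j x = s * p j * ?H F (Suc n) x" if "j \<le> n" for j
      using zero[of j] that by (simp add: G_def H' algebra_simps)
    \<comment> \<open>The coefficient is positive unless \<open>s = 1\<close> on the equator. In
      that case \<open>low\<close> makes the signed increments a multiple of the generic direction,
      hence zero.\<close>
    have top: "((1 - s) + s * \<bar>x (Suc n)\<bar>) * ?H F (Suc n) x = 0"
      using zero[of "Suc n"] by (simp add: G_def algebra_simps)
    have "?H F (Suc n) x = 0"
    proof (cases "s = 1 \<and> x (Suc n) = 0")
      case True
      then have "x \<in> topspace (nsphere n)"
        using topspace_nsphere_minus1[OF x] by simp
      moreover have "signed_incr (F j) n x = (?H F (Suc n) x / t ^ Suc n) * t ^ j" if "j \<le> Suc n" for j
      proof (cases "j \<le> n")
        case j: True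
        then show ?thesis
          using low[OF j] True by (simp add: signed_incr_Suc_equator p_def)
      next
        case False
        then have "j = Suc n" using that by simp
        then show ?thesis
          using True \<open>t \<noteq> 0\<close> by (simp add: signed_incr_Suc_equator)
      qed
      ultimately have "?H F (Suc n) x / t ^ Suc n = 0"
        using t by blast
      then show ?thesis using \<open>t \<noteq> 0\<close> by simp
    next
      case False
      then have "(1 - s) + s * \<bar>x (Suc n)\<bar> > 0"
        using s by (cases "s = 1") (auto intro: add_pos_nonneg)
      then show ?thesis using top by simp
    qed
    then have "?H F j x = 0" if "j \<le> Suc n" for j
      using low[of j] that by (cases "j = Suc n") auto
    then show False
      using Suc.prems(3)[OF x] by blast
  qed
  define f where "f = unit_map (Suc n) G"
  have eq: "Brouwer_degree2 (Suc n) (unit_map (Suc n) (?H F)) = Brouwer_degree2 (Suc n) f"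
    unfolding f_def
    by (rule Brouwer_degree2_unit_map_homotopic) (use contG nz Suc.prems(2) continuous_map_signed_incr in auto)
  have contf: "continuous_map (nsphere (Suc n)) (nsphere (Suc n)) f"
    unfolding f_def using contG nz[of _ 1] by (intro continuous_map_unit_map) auto
  have equator: "f x = unit_map n (\<lambda>j. signed_incr (F' j) n) x" "\<exists>j\<le>n. signed_incr (F' j) n x \<noteq> 0"
    if "x \<in> topspace (nsphere n)" for x
  proof -
    have x0: "x (Suc n) = 0"
      using that by (simp add: topspace_nsphere_eq)
    have G: "G j x = (if j \<le> n then signed_incr (F' j) n x else 0)" for j
      by (simp add: G_def x0 signed_incr_Suc_equator)
    then show "f x = unit_map n (\<lambda>j. signed_incr (F' j) n) x"
      by (auto simp: f_def unit_map_def fun_eq_iff)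
    have "x \<in> topspace (nsphere (Suc n))"
      using that by (auto simp: topspace_nsphere_eq)
    \<comment> \<open>At parameter 1 the homotopy is \<open>G\<close> itself, whose last coordinate
      vanishes on the equator, so one of the others does not.\<close>
    from nz[OF this, of 1] show "\<exists>j\<le>n. signed_incr (F' j) n x \<noteq> 0"
      by (auto simp: G split: if_splits)
  qed
  have unit_eq: "continuous_map (nsphere n) (nsphere n) (unit_map n (\<lambda>j. signed_incr (F' j) n))"
    using equator(2) by (intro continuous_map_unit_map continuous_map_signed_incr cont')
  \<comment> \<open>An odd self-map that preserves the equator has degree of the same parity as its
    restriction there.\<close>
  have "even (Brouwer_degree2 (Suc n) f - Brouwer_degree2 (Suc n - Suc 0) f)"
  proof (rule Borsuk_odd_mapping_degree_step[OF contf])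
    show "(f \<circ> (\<lambda>x i. - x i)) u = ((\<lambda>x i. - x i) \<circ> f) u" for u
      by (auto simp: f_def unit_map_def G_def signed_incr_uminus fun_eq_iff)
    show "f \<in> topspace (nsphere (Suc n - Suc 0)) \<rightarrow> topspace (nsphere (Suc n - Suc 0))"
      using continuous_map_funspace[OF unit_eq] equator(1) by auto
  qed
  moreover have "Brouwer_degree2 n f = Brouwer_degree2 n (unit_map n (\<lambda>j. signed_incr (F' j) n))"
    by (rule Brouwer_degree2_eq) (rule equator)
  moreover have "odd (Brouwer_degree2 n (unit_map n (\<lambda>j. signed_incr (F' j) n)))"
    using equator(2) piecewise_affine_shear[OF Suc.prems(1), of p "Suc n"] cont'
    by (intro Suc.IH) (auto simp: F'_def)
  ultimately show ?case
    using eq by auto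
qed

subsection \<open>The Hobby--Rice theorem\<close>

text \<open>The sphere is closed in a product of copies of \<open>{-1..1}\<close>, which is compact
  by Tychonoff.\<close>

lemma compact_space_nsphere: "compact_space (nsphere n)"
proof -
  have "compactin (powertop_real UNIV) (PiE UNIV (\<lambda>i::nat. {-1..1::real}))"
    by (simp add: compactin_PiE)
  moreover have "closedin (powertop_real UNIV) (topspace (nsphere n))"
  proof -
    have "topspace (nsphere n) = {x. (\<Sum>i\<le>n. (x i)\<^sup>2) = 1} \<inter> (\<Inter>i\<in>{n<..}. {x. x i = 0})"
      by (auto simp: topspace_nsphere_eq)
    moreover have "closed ({x::nat \<Rightarrow> real. (\<Sum>i\<le>n. (x i)\<^sup>2) = 1} \<inter> (\<Inter>i\<in>{n<..}. {x. x i = 0}))"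
      by (intro closed_Int closed_INT ballI closed_Collect_eq continuous_on_sum continuous_on_power
          continuous_on_const continuous_on_product_coordinates)
    ultimately have "closed (topspace (nsphere n))"
      by simp
    then show ?thesis
      by (simp add: euclidean_product_topology)
  qed
  moreover have "topspace (nsphere n) \<subseteq> PiE UNIV (\<lambda>i. {-1..1})"
  proof
    fix x assume "x \<in> topspace (nsphere n)"
    then have "\<bar>x i\<bar> \<le> 1" for i
      using topspace_nsphere_1 abs_square_le_1 by blast
    then show "x \<in> PiE UNIV (\<lambda>i. {-1..1})"
      by (simp add: PiE_iff abs_le_iff minus_le_iff)
  qed
  ultimately have "compactin (powertop_real UNIV) (topspace (nsphere n))"
    using closed_compactin by blast
  then show ?thesis
    by (metis compact_space_subtopology nsphere topspace_nsphere_eq)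
qed

lemma continuous_map_nsphere_pos_lower_bound:
  assumes "continuous_map (nsphere n) euclideanreal h" "\<And>x. x \<in> topspace (nsphere n) \<Longrightarrow> h x > 0"
  obtains e where "e > 0" "\<And>x. x \<in> topspace (nsphere n) \<Longrightarrow> h x \<ge> e"
proof -
  have "compact (h ` topspace (nsphere n))"
    using image_compactin[OF _ assms(1)] compact_space_nsphere by (auto simp: compact_space_def)
  moreover have "h ` topspace (nsphere n) \<noteq> {}"
    using in_topspace_nsphere by blast
  ultimately obtain e where "e \<in> h ` topspace (nsphere n)" "\<forall>y\<in>h ` topspace (nsphere n). e \<le> y"
    using compact_attains_inf by blast
  then show thesis
    using that assms(2) by blast
qed

section \<open>Piecewise affine interpolation on a uniform grid\<close>

definition hat :: "real \<Rightarrow> real" where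
  "hat u = max 0 (1 - \<bar>u\<bar>)"

text \<open>The nodes run to \<open>Suc M\<close>, one past the right end 1 of the interval: the
  cell of index \<open>M\<close> that starts at \<open>t = 1\<close> then has a right node too, and
  \<open>interpolant_eq\<close> needs no special case.\<close>

definition interpolant :: "nat \<Rightarrow> (real \<Rightarrow> real) \<Rightarrow> real \<Rightarrow> real" where
  "interpolant M g t = (\<Sum>l\<le>Suc M. g (real l / real M) * hat (real M * t - real l))"

lemma continuous_on_interpolant: "continuous_on UNIV (interpolant M g)"
  unfolding interpolant_def hat_def by (intro continuous_intros)

lemma interpolant_eq:
  assumes "l \<le> M" "real l \<le> real M * t" "real M * t \<le> real l + 1"
  shows "interpolant M g t = (1 - (real M * t - real l)) * g (real l / real M)
           + (real M * t - real l) * g (real (Suc l) / real M)"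
proof -
  have "interpolant M g t = (\<Sum>i\<in>{l, Suc l}. g (real i / real M) * hat (real M * t - real i))"
    unfolding interpolant_def
  proof (rule sum.mono_neutral_right)
    show "\<forall>i\<in>{..Suc M} - {l, Suc l}. g (real i / real M) * hat (real M * t - real i) = 0"
    proof
      fix i assume "i \<in> {..Suc M} - {l, Suc l}"
      then have "i < l \<or> i > Suc l" by auto
      then have "real i \<le> real l - 1 \<or> real i \<ge> real l + 2" by auto
      then have "hat (real M * t - real i) = 0"
        using assms by (auto simp: hat_def)
      then show "g (real i / real M) * hat (real M * t - real i) = 0" by simp
    qed
  qed (use assms in auto)
  then show ?thesis
    using assms by (simp add: hat_def max_def algebra_simps)
qed

lemma unit_interval_cell:
  assumes "M > 0" "t \<in> {0..1}"
  obtains l where "l \<le> M" "real l \<le> real M * t" "real M * t \<le> real l + 1"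
proof
  have "real M * t \<le> real M"
    using assms by (simp add: mult_left_le)
  then show "nat \<lfloor>real M * t\<rfloor> \<le> M"
    by (simp add: nat_le_iff floor_le_iff)
  show "real (nat \<lfloor>real M * t\<rfloor>) \<le> real M * t" "real M * t \<le> real (nat \<lfloor>real M * t\<rfloor>) + 1"
    using assms by (auto simp: of_nat_nat)
qed

lemma piecewise_affine_interpolant:
  assumes "M > 0"
  shows "piecewise_affine (\<lambda>j. interpolant M (g j))"
  unfolding piecewise_affine_def
proof (intro exI conjI ballI)
  let ?a = "\<lambda>l j. (1 + real l) * g j (real l / real M) - real l * g j (real (Suc l) / real M)"
  let ?b = "\<lambda>l j. real M * (g j (real (Suc l) / real M) - g j (real l / real M))"
  show "finite ((\<lambda>l. (?a l, ?b l)) ` {..M})" by simp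
  fix t :: real assume "t \<in> {0..1}"
  then obtain l where l: "l \<le> M" "real l \<le> real M * t" "real M * t \<le> real l + 1"
    using unit_interval_cell assms by blast
  show "\<exists>(a, b)\<in>(\<lambda>l. (?a l, ?b l)) ` {..M}. \<forall>j. interpolant M (g j) t = a j + b j * t"
    by (rule bexI[of _ "(?a l, ?b l)"]) (use l(1) in \<open>auto simp: interpolant_eq[OF l] algebra_simps\<close>)
qed

lemma interpolant_approx:
  assumes "continuous_on UNIV g" "e > 0"
  shows "eventually (\<lambda>M. \<forall>t\<in>{0..1}. \<bar>interpolant M g t - g t\<bar> < e) sequentially"
proof -
  \<comment> \<open>The interval reaches 2 because the extra node
    \<open>real (Suc M) / real M\<close> may be that large.\<close>
  have "uniformly_continuous_on {0..2} g"
    using assms(1) by (intro compact_uniformly_continuous) (auto intro: continuous_on_subset)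
  then obtain d where d: "d > 0"
      "\<And>s t. s \<in> {0..2} \<Longrightarrow> t \<in> {0..2} \<Longrightarrow> \<bar>s - t\<bar> < d \<Longrightarrow> \<bar>g s - g t\<bar> < e"
    using assms(2) unfolding uniformly_continuous_on_def dist_real_def by metis
  obtain M0 where M0: "M0 > 0" "inverse (real M0) < d"
    using d(1) ex_inverse_of_nat_less by blast
  have "\<bar>interpolant M g t - g t\<bar> < e" if M: "M \<ge> M0" and t: "t \<in> {0..1}" for M t
  proof -
    have pos: "real M > 0" using M M0 by simp
    have "1 / real M \<le> 1 / real M0"
      using M M0 by (intro divide_left_mono) auto
    then have inv: "1 / real M < d"
      using M0 by (simp add: inverse_eq_divide)
    obtain l where l: "l \<le> M" "real l \<le> real M * t" "real M * t \<le> real l + 1"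
      using unit_interval_cell pos t by (metis of_nat_0_less_iff)
    define u where "u = real M * t - real l"
    have u: "0 \<le> u" "u \<le> 1" using l by (auto simp: u_def)
    have a: "t - real l / real M = u / real M" "real (Suc l) / real M - t = (1 - u) / real M"
      using pos by (simp_all add: u_def field_simps)
    have "u / real M \<le> 1 / real M" "(1 - u) / real M \<le> 1 / real M" "0 \<le> u / real M" "0 \<le> (1 - u) / real M"
      using u pos by (auto intro: divide_right_mono)
    then have near: "\<bar>real l / real M - t\<bar> < d" "\<bar>real (Suc l) / real M - t\<bar> < d"
      using a inv by linarith+
    have "real l / real M \<in> {0..2}" "real (Suc l) / real M \<in> {0..2}"
      using l(1) pos by (auto simp: field_simps)
    then have g: "\<bar>g (real l / real M) - g t\<bar> < e" "\<bar>g (real (Suc l) / real M) - g t\<bar> < e"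
      using d(2) near t by auto
    have "interpolant M g t - g t = (1 - u) * (g (real l / real M) - g t) + u * (g (real (Suc l) / real M) - g t)"
      using interpolant_eq[OF l, of g] by (simp add: u_def algebra_simps)
    also have "\<bar>\<dots>\<bar> \<le> (1 - u) * \<bar>g (real l / real M) - g t\<bar> + u * \<bar>g (real (Suc l) / real M) - g t\<bar>"
      using u by (intro order.trans[OF abs_triangle_ineq]) (simp add: abs_mult)
    also have "\<dots> < e"
      using g u by (intro convex_bound_lt) auto
    finally show ?thesis .
  qed
  then show ?thesis
    unfolding eventually_sequentially by blast
qed

lemma signed_incr_diff_bound:
  assumes "x \<in> topspace (nsphere n)" "\<And>t. t \<in> {0..1} \<Longrightarrow> \<bar>f t - g t\<bar> \<le> d"
  shows "\<bar>signed_incr f n x - signed_incr g n x\<bar> \<le> 2 * (real n + 1) * d"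
proof -
  have "\<bar>signed_incr f n x - signed_incr g n x\<bar> =
      \<bar>\<Sum>i\<le>n. sgn (x i) * ((f (psq x (Suc i)) - g (psq x (Suc i))) - (f (psq x i) - g (psq x i)))\<bar>"
    by (simp add: signed_incr_def algebra_simps flip: sum_subtractf)
  also have "\<dots> \<le> (\<Sum>i\<le>n. 2 * d)"
  proof (intro sum_abs[THEN order.trans] sum_mono)
    fix i assume i: "i \<in> {..n}"
    then have "\<bar>f (psq x (Suc i)) - g (psq x (Suc i))\<bar> \<le> d" "\<bar>f (psq x i) - g (psq x i)\<bar> \<le> d"
      using psq_bounds[OF assms(1)] assms(2) by auto
    then have "\<bar>(f (psq x (Suc i)) - g (psq x (Suc i))) - (f (psq x i) - g (psq x i))\<bar> \<le> 2 * d"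
      by linarith
    then show "\<bar>sgn (x i) * ((f (psq x (Suc i)) - g (psq x (Suc i))) - (f (psq x i) - g (psq x i)))\<bar> \<le> 2 * d"
      by (auto simp: sgn_if)
  qed
  finally show ?thesis
    by (simp add: algebra_simps)
qed

text \<open>Without a common zero, compactness bounds the increments away from 0 jointly, so close
  piecewise affine interpolants have no common zero either. Padded by a zero coordinate they give a
  self-map of the sphere of odd degree that misses a pole, hence has degree 0.\<close>

theorem Hobby_Rice:
  fixes F :: "nat \<Rightarrow> real \<Rightarrow> real"
  assumes cont: "\<And>j. j < n \<Longrightarrow> continuous_on UNIV (F j)"
  shows "\<exists>x\<in>topspace (nsphere n). \<forall>j<n. signed_incr (F j) n x = 0"
proof (rule ccontr)
  assume "\<not> ?thesis"
  then have nz: "\<exists>j<n. signed_incr (F j) n x \<noteq> 0" if "x \<in> topspace (nsphere n)" for x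
    using that by blast
  have "continuous_map (nsphere n) euclideanreal (\<lambda>x. \<Sum>j<n. \<bar>signed_incr (F j) n x\<bar>)"
    using cont by (intro continuous_intros continuous_map_signed_incr) auto
  moreover have "(\<Sum>j<n. \<bar>signed_incr (F j) n x\<bar>) > 0" if "x \<in> topspace (nsphere n)" for x
    using nz[OF that] by (auto intro: sum_pos2)
  ultimately obtain e where e: "e > 0"
      "\<And>x. x \<in> topspace (nsphere n) \<Longrightarrow> (\<Sum>j<n. \<bar>signed_incr (F j) n x\<bar>) \<ge> e"
    using continuous_map_nsphere_pos_lower_bound by blast
  \<comment> \<open>Each of the \<open>n\<close> increments changes by at most
    \<open>2 * (real n + 1) * d\<close>, in total \<open>e * (real n / (real n + 1))\<close>, which
    is below \<open>e\<close>.\<close>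
  define d where "d = e / (2 * (real n + 1) ^ 2)"
  have "d > 0" using e by (simp add: d_def)
  have "eventually (\<lambda>M. \<forall>j\<in>{..<n}. \<forall>t\<in>{0..1}. \<bar>interpolant M (F j) t - F j t\<bar> < d) sequentially"
    using cont \<open>d > 0\<close> by (intro eventually_ball_finite ballI interpolant_approx) auto
  from eventually_conj[OF this eventually_gt_at_top[of 0]]
  obtain M where M: "M > 0" "\<And>j t. j < n \<Longrightarrow> t \<in> {0..1} \<Longrightarrow> \<bar>interpolant M (F j) t - F j t\<bar> < d"
    by (auto dest!: eventually_happens)
  \<comment> \<open>The zero function at index \<open>n\<close> supplies the last of the
    \<open>n + 1\<close> coordinates of the target.\<close>
  define g where "g j = (if j < n then F j else (\<lambda>_. 0))" for j
  define P where "P j = interpolant M (g j)" for j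
  have P_n: "P n = (\<lambda>_. 0)"
    by (simp add: P_def g_def interpolant_def fun_eq_iff)
  have nzP: "\<exists>j<n. signed_incr (P j) n x \<noteq> 0" if x: "x \<in> topspace (nsphere n)" for x
  proof (rule ccontr)
    assume "\<not> ?thesis"
    then have "\<bar>signed_incr (F j) n x\<bar> \<le> 2 * (real n + 1) * d" if "j < n" for j
      using signed_incr_diff_bound[OF x, of "P j" "F j" d] M(2)[OF that] that
      by (auto simp: P_def g_def less_imp_le)
    then have "(\<Sum>j<n. \<bar>signed_incr (F j) n x\<bar>) \<le> (\<Sum>j<n. 2 * (real n + 1) * d)"
      by (intro sum_mono) auto
    also have "\<dots> = e * (real n / (real n + 1))"
      by (simp add: d_def power2_eq_square divide_simps)
    also have "\<dots> < e * 1"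
      using e(1) by (intro mult_strict_left_mono) auto
    finally show False
      using e(2)[OF x] by simp
  qed
  let ?f = "unit_map n (\<lambda>j. signed_incr (P j) n)"
  have contP: "continuous_on UNIV (P j)" for j
    by (simp add: P_def continuous_on_interpolant)
  have nzP': "\<exists>j\<le>n. signed_incr (P j) n x \<noteq> 0" if "x \<in> topspace (nsphere n)" for x
    using nzP[OF that] less_imp_le by blast
  have "odd (Brouwer_degree2 n ?f)"
    using nzP' contP piecewise_affine_interpolant[OF M(1)]
    by (intro odd_degree_signed_incr) (auto simp: P_def)
  moreover have "Brouwer_degree2 n ?f = 0"
  proof (rule Brouwer_degree2_nonsurjective)
    show "continuous_map (nsphere n) (nsphere n) ?f"
      using nzP' by (intro continuous_map_unit_map continuous_map_signed_incr contP)
    have "(\<lambda>i. if i = n then 1 else 0) \<in> topspace (nsphere n)"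
      by (simp add: topspace_nsphere_eq if_distrib[of "\<lambda>u. u\<^sup>2"] cong: if_cong)
    moreover have "?f x n = 0" for x
      by (simp add: unit_map_def P_n)
    then have "(\<lambda>i. if i = n then 1 else 0) \<notin> ?f ` topspace (nsphere n)"
      by (metis (mono_tags, lifting) imageE zero_neq_one)
    ultimately show "?f ` topspace (nsphere n) \<noteq> topspace (nsphere n)"
      by blast
  qed
  ultimately show False by simp
qed

subsection \<open>Dependent chords\<close>

text \<open>Empty intervals are dropped and neighbours of equal sign are merged. The remaining signs
  alternate, so they are determined by the first one, \<open>\<sigma>\<close>.\<close>

lemma alternating_normal_form:
  fixes s e :: "nat \<Rightarrow> real"
  assumes "\<And>i. i < n \<Longrightarrow> s i \<le> s (Suc i)" "\<And>i. i < n \<Longrightarrow> s i < s (Suc i) \<Longrightarrow> e i = 1 \<or> e i = - 1"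
  shows "\<exists>m p \<sigma>. m \<le> n \<and> (\<sigma> = 1 \<or> \<sigma> = - 1) \<and> p 0 = s 0 \<and> p m = s n \<and> (\<forall>i<m. p i < p (Suc i)) \<and>
    (\<forall>g :: real \<Rightarrow> real. (\<Sum>i<n. e i * (g (s (Suc i)) - g (s i))) =
      \<sigma> * (\<Sum>i<m. (- 1) ^ i * (g (p (Suc i)) - g (p i))))"
  using assms
proof (induction n)
  case 0
  show ?case
    by (rule exI[of _ 0], rule exI[of _ s], rule exI[of _ 1]) simp
next
  case (Suc n)
  have "\<And>i. i < n \<Longrightarrow> s i \<le> s (Suc i)" "\<And>i. i < n \<Longrightarrow> s i < s (Suc i) \<Longrightarrow> e i = 1 \<or> e i = - 1"
    using Suc.prems by auto
  from Suc.IH[OF this] obtain m p \<sigma> where IH: "m \<le> n" "\<sigma> = 1 \<or> \<sigma> = - 1" "p 0 = s 0" "p m = s n" "\<forall>i<m. p i < p (Suc i)"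
    "\<forall>g :: real \<Rightarrow> real. (\<Sum>i<n. e i * (g (s (Suc i)) - g (s i))) =
      \<sigma> * (\<Sum>i<m. (- 1) ^ i * (g (p (Suc i)) - g (p i)))"
    by blast
  \<comment> \<open>The case where the new interval becomes a piece of its own, because it continues
    the alternation or because there is no piece yet and its sign becomes the leading one.\<close>
  have append: ?case if \<sigma>': "\<sigma>' = 1 \<or> \<sigma>' = - 1" "s n < s (Suc n)" "e n = \<sigma>' * (- 1) ^ m" "m = 0 \<or> \<sigma>' = \<sigma>" for \<sigma>'
  proof (rule exI[of _ "Suc m"], rule exI[of _ "p(Suc m := s (Suc n))"], rule exI[of _ \<sigma>'], intro conjI allI impI)
    fix g :: "real \<Rightarrow> real"
    show "(\<Sum>i<Suc n. e i * (g (s (Suc i)) - g (s i))) = \<sigma>' * (\<Sum>i<Suc m. (- 1) ^ i *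
        (g ((p(Suc m := s (Suc n))) (Suc i)) - g ((p(Suc m := s (Suc n))) i)))"
      using \<sigma>' IH(4) by (auto simp: IH(6)[rule_format] distrib_left)
  qed (use IH \<sigma>' in \<open>auto simp: less_Suc_eq\<close>)
  show ?case
  proof (cases "s n < s (Suc n)")
    case False
    then have "s (Suc n) = s n"
      using Suc.prems(1)[of n] by simp
    then show ?thesis
      using IH by (intro exI[of _ m] exI[of _ p] exI[of _ \<sigma>]) auto
  next
    case lt: True
    then have en: "e n = 1 \<or> e n = - 1"
      using Suc.prems(2) by blast
    show ?thesis
    proof (cases m)
      case 0
      then show ?thesis
        using append[of "e n"] en lt by simp
    next
      case (Suc m')
      show ?thesis
      proof (cases "e n = \<sigma> * (- 1) ^ m")
        case True
        then show ?thesis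
          using append[of \<sigma>] IH(2) lt by blast
      next
        case False
        then have e: "e n = \<sigma> * (- 1) ^ m'"
          using en IH(2) Suc by (cases "even m'") auto
        \<comment> \<open>The new interval repeats the sign of the last piece, so the last
          breakpoint is moved instead.\<close>
        show ?thesis
        proof (rule exI[of _ m], rule exI[of _ "p(m := s (Suc n))"], rule exI[of _ \<sigma>], intro conjI allI impI)
          fix g :: "real \<Rightarrow> real"
          define T where "T = (\<Sum>i<m'. (- 1) ^ i * (g (p (Suc i)) - g (p i)))"
          have "(\<Sum>i<n. e i * (g (s (Suc i)) - g (s i))) = \<sigma> * (T + (- 1) ^ m' * (g (s n) - g (p m')))"
            using IH(4) by (simp add: IH(6)[rule_format] Suc T_def)
          moreover have "(\<Sum>i<m. (- 1) ^ i * (g ((p(m := s (Suc n))) (Suc i)) - g ((p(m := s (Suc n))) i)))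
              = T + (- 1) ^ m' * (g (s (Suc n)) - g (p m'))"
            by (simp add: Suc T_def)
          ultimately show "(\<Sum>i<Suc n. e i * (g (s (Suc i)) - g (s i))) = \<sigma> * (\<Sum>i<m. (- 1) ^ i *
              (g ((p(m := s (Suc n))) (Suc i)) - g ((p(m := s (Suc n))) i)))"
            by (simp only: sum.lessThan_Suc e) (simp add: algebra_simps)
        next
          fix i assume "i < m"
          then show "(p(m := s (Suc n))) i < (p(m := s (Suc n))) (Suc i)"
            using IH(4,5) lt Suc by (auto simp: less_Suc_eq)
        qed (use IH Suc in auto)
      qed
    qed
  qed
qed

lemma sum_lessThan_double:
  fixes h :: "nat \<Rightarrow> real"
  shows "(\<Sum>i<2 * j. h i) = (\<Sum>l<j. h (2 * l) + h (2 * l + 1))"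
  by (induction j) auto

text \<open>The identity is appended to the given functions in the Hobby--Rice theorem so as to exclude the
  constant sign pattern, which every periodic function annihilates.\<close>

lemma dependent_chords_exist:
  fixes f :: "nat \<Rightarrow> real \<Rightarrow> real"
  assumes cont: "\<And>a. a < N \<Longrightarrow> continuous_on UNIV (f a)"
    and per: "\<And>a x. a < N \<Longrightarrow> f a (x + 2 * pi) = f a x"
  obtains j q where "1 \<le> j" "2 * j \<le> N + 2" "inj_on q {..<2 * j}" "q ` {..<2 * j} \<subseteq> {0..<2 * pi}"
    "\<And>a. a < N \<Longrightarrow> (\<Sum>l<j. f a (q (2 * l + 1)) - f a (q (2 * l))) = 0"
proof -
  define F where "F a = (if a < N then (\<lambda>t. f a (2 * pi * t)) else (\<lambda>t. t))" for a
  have "continuous_on UNIV (F a)" for a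
    unfolding F_def by (auto intro!: continuous_intros continuous_on_compose2[OF cont])
  then obtain x where x: "x \<in> topspace (nsphere (Suc N))" "\<And>a. a < Suc N \<Longrightarrow> signed_incr (F a) (Suc N) x = 0"
    using Hobby_Rice[of "Suc N" F] by blast
  have "psq x i \<le> psq x (Suc i)" "psq x i < psq x (Suc i) \<Longrightarrow> sgn (x i) = 1 \<or> sgn (x i) = - 1" for i
    by (auto simp: psq_def sgn_if)
  from alternating_normal_form[of "Suc (Suc N)" "psq x" "\<lambda>i. sgn (x i)", OF this]
  obtain m p \<sigma> where m: "m \<le> Suc (Suc N)" and \<sigma>: "\<sigma> = 1 \<or> \<sigma> = - 1" and p: "p 0 = psq x 0" "p m = psq x (Suc (Suc N))"
      "\<forall>i<m. p i < p (Suc i)"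
      and sums: "\<forall>g :: real \<Rightarrow> real. (\<Sum>i<Suc (Suc N). sgn (x i) * (g (psq x (Suc i)) - g (psq x i))) =
        \<sigma> * (\<Sum>i<m. (- 1) ^ i * (g (p (Suc i)) - g (p i)))"
    by blast
  have "psq x 0 = 0"
    by (simp add: psq_def)
  then have p01: "p 0 = 0" "p m = 1"
    using p psq_Suc_nsphere[OF x(1)] by simp_all
  have alt: "(\<Sum>i<m. (- 1) ^ i * (F a (p (Suc i)) - F a (p i))) = 0" if "a < Suc N" for a
    using sums[rule_format, of "F a"] x(2)[OF that] \<sigma> unfolding signed_incr_def lessThan_Suc_atMost by auto
  have "m \<noteq> 0"
    using p01 by (metis zero_neq_one)
  \<comment> \<open>With one interval the alternating sum of the identity \<open>F N\<close> would
    be 1.\<close>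
  moreover have "m \<noteq> 1"
    using alt[of N] p01 by (auto simp: F_def)
  ultimately have "m \<ge> 2" by linarith
  have p_less: "p i < p i'" if "i < i'" "i' \<le> m" for i i'
    using that
  proof (induction i')
    case (Suc i')
    then show ?case
      using p(3) by (metis Suc_le_eq less_Suc_eq less_trans order_less_imp_le)
  qed simp
  \<comment> \<open>The points 0 and 1 coincide on the circle. For even \<open>m\<close> the point
    \<open>p m\<close> is left out, for odd \<open>m\<close> both ends are, so \<open>2 * j\<close>
    distinct points remain, starting at index \<open>r\<close>.\<close>
  define j where "j = m div 2"
  define r where "r = m mod 2"
  have mjr: "m = 2 * j + r" "r = 0 \<or> r = 1"
    by (auto simp: j_def r_def)
  define q where "q i = 2 * pi * p (i + r)" for i
  have q_less: "q i < q i'" if "i < i'" "i' < 2 * j" for i i'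
    using p_less[of "i + r" "i' + r"] that mjr by (simp add: q_def)
  have inj: "inj_on q {..<2 * j}"
  proof (rule inj_onI)
    fix i i' assume "i \<in> {..<2 * j}" "i' \<in> {..<2 * j}" "q i = q i'"
    then show "i = i'"
      using q_less[of i i'] q_less[of i' i] by (metis lessThan_iff less_irrefl linorder_neqE_nat)
  qed
  have range: "q ` {..<2 * j} \<subseteq> {0..<2 * pi}"
  proof clarsimp
    fix i assume "i < 2 * j"
    then have "0 \<le> p (i + r)" "p (i + r) < 1"
      using p_less[of 0 "i + r"] p_less[of "i + r" m] p01 mjr
      by (cases "i + r = 0"; auto)+
    then show "0 \<le> q i \<and> q i < 2 * pi"
      by (simp add: q_def)
  qed
  have "(\<Sum>l<j. f a (q (2 * l + 1)) - f a (q (2 * l))) = 0" if a: "a < N" for a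
  proof -
    define D where "D i = F a (p (Suc i)) - F a (p i)" for i
    have D: "D (i + r) = f a (q (i + 1)) - f a (q i)" for i
      using a by (simp add: D_def F_def q_def)
    have alt: "(\<Sum>i<m. (- 1) ^ i * D i) = 0"
      using alt a by (simp add: D_def)
    have "(\<Sum>i<m. D i) = F a (p m) - F a (p 0)"
      unfolding D_def by (rule sum_lessThan_telescope)
    also have "\<dots> = 0"
      using per[OF a, of 0] a by (simp add: p01 F_def)
    finally have tele: "(\<Sum>i<m. D i) = 0" .
    \<comment> \<open>Adding the alternating sum to the telescoping one keeps the even intervals,
      subtracting it keeps the odd ones. These are the chords.\<close>
    have "(\<Sum>l<j. D (2 * l + r)) = 0"
      using mjr(2)
    proof
      assume r: "r = 0"
      have "0 = (\<Sum>i<m. D i) + (\<Sum>i<m. (- 1) ^ i * D i)"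
        using alt tele by simp
      also have "\<dots> = (\<Sum>i<2 * j. (1 + (- 1) ^ i) * D i)"
        using mjr(1) r by (simp add: algebra_simps sum.distrib)
      also have "\<dots> = 2 * (\<Sum>l<j. D (2 * l + r))"
        by (simp add: sum_lessThan_double r sum_distrib_left)
      finally show ?thesis by simp
    next
      assume r: "r = 1"
      have "0 = (\<Sum>i<m. D i) - (\<Sum>i<m. (- 1) ^ i * D i)"
        using alt tele by simp
      also have "\<dots> = (\<Sum>i<Suc (2 * j). (1 - (- 1) ^ i) * D i)"
        using mjr(1) r by (simp add: algebra_simps sum_subtractf)
      also have "\<dots> = 2 * (\<Sum>l<j. D (2 * l + r))"
        unfolding sum.lessThan_Suc_shift sum_lessThan_double by (simp add: r sum_distrib_left)
      finally show ?thesis by simp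
    qed
    then show ?thesis
      by (simp add: D)
  qed
  moreover have "1 \<le> j" "2 * j \<le> N + 2"
    using \<open>m \<ge> 2\<close> m by (auto simp: j_def)
  ultimately show thesis
    using that inj range by blast
qed

text \<open>Supplies distinct endpoints for the chords beyond the first \<open>j\<close>; removing
  finitely many points leaves an infinite set.\<close>

lemma inj_on_extension:
  fixes q :: "nat \<Rightarrow> 'a"
  assumes "inj_on q {..<m}" "q ` {..<m} \<subseteq> S" "infinite S"
  obtains q' where "inj q'" "range q' \<subseteq> S" "\<And>i. i < m \<Longrightarrow> q' i = q i"
proof -
  have "infinite (S - q ` {..<m})"
    using assms(3) by simp
  then obtain r :: "nat \<Rightarrow> 'a" where r: "inj r" "range r \<subseteq> S - q ` {..<m}"
    using infinite_countable_subset by blast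
  define q' where "q' i = (if i < m then q i else r i)" for i
  have "inj q'"
    using assms(1) r by (auto simp: inj_on_def q'_def subset_iff split: if_splits)
      (metis imageI lessThan_iff rangeI)+
  moreover have "range q' \<subseteq> S"
    using assms(2) r(2) by (fastforce simp: q'_def)
  ultimately show thesis
    using that by (simp add: q'_def)
qed

lemma same_pt_S1_fundamental_domain:
  assumes "x \<in> {0..<2 * pi}" "y \<in> {0..<2 * pi}" "same_pt_S1 x y"
  shows "x = y"
proof -
  obtain z :: int where z: "(x - y) / (2 * pi) = of_int z"
    using assms(3) unfolding same_pt_S1_def by (elim Ints_cases)
  have "\<bar>(x - y) / (2 * pi)\<bar> < 1"
    using assms(1,2) by (auto simp: abs_less_iff divide_simps)
  then have "z = 0"
    unfolding z by linarith
  then show ?thesis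
    using z by simp
qed

subsection \<open>Equilevel algebras\<close>

text \<open>If \<open>\<phi> v \<noteq> 0\<close>, subtracting a multiple of \<open>v\<close> moves
  any element of \<open>V\<close> into the kernel, so a basis of the kernel together with
  \<open>v\<close> spans \<open>V\<close>. The finite set \<open>B\<close> keeps the bases finite,
  so that \<open>dim\<close> counts properly.\<close>

lemma dim_kernel_functional:
  assumes V: "fvs.subspace V" "V \<subseteq> fvs.span B" "finite B"
    and add: "\<And>f g. \<phi> (f + g) = \<phi> f + \<phi> g" and scale: "\<And>c f. \<phi> (fscale c f) = c * \<phi> f"
  shows "fvs.dim V \<le> Suc (fvs.dim {f \<in> V. \<phi> f = (0::real)})"
proof -
  obtain C where C: "C \<subseteq> {f \<in> V. \<phi> f = 0}" "fvs.independent C" "{f \<in> V. \<phi> f = 0} \<subseteq> fvs.span C"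
      "card C = fvs.dim {f \<in> V. \<phi> f = 0}"
    by (rule fvs.basis_exists)
  have "finite C"
    using fvs.independent_span_bound[OF V(3) C(2)] C(1) V(2) by blast
  have "\<exists>v. V \<subseteq> fvs.span (insert v C)"
  proof (cases "\<exists>v\<in>V. \<phi> v \<noteq> 0")
    case True
    then obtain v where v: "v \<in> V" "\<phi> v \<noteq> 0" by blast
    have "f \<in> fvs.span (insert v C)" if f: "f \<in> V" for f
    proof -
      define g where "g = f + fscale (- (\<phi> f / \<phi> v)) v"
      have "g \<in> V"
        unfolding g_def using V(1) f v(1) by (intro fvs.subspace_add fvs.subspace_scale)
      moreover have "\<phi> g = 0"
        unfolding g_def add scale using v(2) by simp
      ultimately have "g \<in> fvs.span (insert v C)"
        using C(3) fvs.span_mono[of C "insert v C"] by blast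
      moreover have "f = g + fscale (\<phi> f / \<phi> v) v"
        by (simp add: g_def fscale_def fun_eq_iff)
      ultimately show ?thesis
        by (metis fvs.span_add fvs.span_scale fvs.span_base insertI1)
    qed
    then show ?thesis by blast
  next
    case False
    then have "V \<subseteq> fvs.span C"
      using C(3) by blast
    then show ?thesis
      using fvs.span_mono[of C] by blast
  qed
  then obtain v where "V \<subseteq> fvs.span (insert v C)" by blast
  then have "fvs.dim V \<le> card (insert v C)"
    using \<open>finite C\<close> by (intro fvs.dim_le_card) auto
  also have "\<dots> \<le> Suc (card C)"
    using \<open>finite C\<close> by (simp add: card_insert_if)
  finally show ?thesis
    by (simp add: C(4))
qed

lemma dim_kernel_functionals:
  assumes V: "fvs.subspace V" "V \<subseteq> fvs.span B" "finite B" and "finite I"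
    and add: "\<And>i f g. \<phi> i (f + g) = \<phi> i f + \<phi> i g" and scale: "\<And>i c f. \<phi> i (fscale c f) = c * \<phi> i f"
  shows "fvs.dim V \<le> card I + fvs.dim {f \<in> V. \<forall>i\<in>I. \<phi> i f = (0::real)}"
  using \<open>finite I\<close>
proof (induction I rule: finite_induct)
  case (insert i I)
  let ?W = "{f \<in> V. \<forall>i\<in>I. \<phi> i f = 0}"
  have "\<phi> i 0 = 0" for i
    using scale[of i 0 0] by (simp add: fscale_def zero_fun_def)
  then have "fvs.subspace ?W"
    using V(1) by (auto simp: fvs.subspace_def add scale)
  then have "fvs.dim ?W \<le> Suc (fvs.dim {f \<in> ?W. \<phi> i f = 0})"
    using V(2,3) add scale by (intro dim_kernel_functional[of _ B]) auto
  moreover have "{f \<in> ?W. \<phi> i f = 0} = {f \<in> V. \<forall>i\<in>insert i I. \<phi> i f = 0}"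
    by auto
  ultimately show ?case
    using insert by simp
qed simp

section \<open>Constant curve germs\<close>

lemma algebraic_germ_const: "algebraic_germ k 1 (\<lambda>_. q)"
proof -
  have "\<exists>P :: real poly poly. P \<noteq> 0 \<and> (\<forall>t\<in>{0..<1}. poly (map_poly (\<lambda>c. poly c t) P) (q j) = 0)" for j
    \<comment> \<open>The witness is the polynomial \<open>y - q j\<close>, with coefficients
      constant in \<open>t\<close>.\<close>
    by (rule exI[of _ "[:[:- q j:], [:1:]:]"]) (simp add: map_poly_pCons)
  then show ?thesis
    by (simp add: algebraic_germ_def)
qed

text \<open>The constant family at \<open>f\<close> is admissible. This inclusion is the direction
  that a lower bound on the dimension uses.\<close>

lemma cond_alg_subset_limit_alg_const: "cond_alg k q \<subseteq> limit_alg k 1 (\<lambda>_. q)"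
proof
  fix f assume f: "f \<in> cond_alg k q"
  have "Cm_continuous_family (2 * k) 1 (\<lambda>_. f)"
    by (simp add: Cm_continuous_family_def)
  with f show "f \<in> limit_alg k 1 (\<lambda>_. q)"
    unfolding limit_alg_def by (auto simp: cond_alg_def intro!: exI[of _ "\<lambda>_. f"])
qed

lemma continuous_on_Cinf_S1: "f \<in> Cinf_S1 \<Longrightarrow> continuous_on UNIV f"
proof -
  assume "f \<in> Cinf_S1"
  then have "f differentiable (at x)" for x
    unfolding Cinf_S1_def smooth_fun_def by (metis (mono_tags, lifting) funpow_0 mem_Collect_eq)
  then show ?thesis
    by (simp add: continuous_at_imp_continuous_on differentiable_imp_continuous_within)
qed

theorem mainTheorem14:
  fixes k N :: nat and L :: "(real \<Rightarrow> real) set"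
  assumes "k \<ge> 1" and "k \<le> N" and "N \<le> 2*k - 2"
    and "fvs.subspace L" and "L \<subseteq> Cinf_S1" and "fvs.dim L = N"
  shows "\<exists>F. equilevel_algebra k F \<and> fvs.dim (F \<inter> L) > N - k"
proof -
  obtain B where B: "B \<subseteq> L" "fvs.independent B" "L \<subseteq> fvs.span B" "card B = N"
    using fvs.basis_exists[of L] assms(6) by metis
  have "finite B"
    using B(4) assms(1,2) by (metis card.infinite le_zero_eq not_one_le_zero order.trans)
  then obtain b where b: "bij_betw b {..<N} B"
    using B(4) by (metis bij_betw_from_nat_into_finite finite_same_card_bij card_lessThan finite_lessThan)
  have bB: "b a \<in> Cinf_S1" if "a < N" for a
    using b B(1) assms(5) that by (auto simp: bij_betw_def)
  obtain j q0 where j: "1 \<le> j" "2 * j \<le> N + 2" and q0: "inj_on q0 {..<2 * j}" "q0 ` {..<2 * j} \<subseteq> {0..<2 * pi}"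
    and dep0: "\<And>a. a < N \<Longrightarrow> (\<Sum>l<j. b a (q0 (2 * l + 1)) - b a (q0 (2 * l))) = 0"
    using dependent_chords_exist[of N b] bB continuous_on_Cinf_S1 by (auto simp: Cinf_S1_def)
  obtain q where q: "inj q" "range q \<subseteq> {0..<2 * pi}" "\<And>i. i < 2 * j \<Longrightarrow> q i = q0 i"
    using inj_on_extension[OF q0] infinite_Ico[of 0 "2 * pi"] by auto
  \<comment> \<open>The upper bound on \<open>N\<close> enters here:
    \<open>2 * j \<le> N + 2 \<le> 2 * k\<close>, so the dependent chords fit among the
    \<open>k\<close> available.\<close>
  have jk: "j \<le> k"
    using j assms(1,3) by linarith
  define \<phi> where "\<phi> i f = f (q (2 * i + 1)) - f (q (2 * i))" for i and f :: "real \<Rightarrow> real"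
  have \<phi>_add: "\<phi> i (f + g) = \<phi> i f + \<phi> i g" and \<phi>_scale: "\<phi> i (fscale c f) = c * \<phi> i f" for i c f g
    by (simp_all add: \<phi>_def fscale_def algebra_simps)
  have "fvs.subspace {f. (\<Sum>l<j. \<phi> l f) = 0}"
    by (auto simp: fvs.subspace_def \<phi>_add \<phi>_scale sum.distrib simp flip: sum_distrib_left) (simp add: \<phi>_def)
  moreover have "B \<subseteq> {f. (\<Sum>l<j. \<phi> l f) = 0}"
  proof
    fix f assume "f \<in> B"
    then obtain a where "a < N" "f = b a"
      using b by (auto simp: bij_betw_def)
    then show "f \<in> {f. (\<Sum>l<j. \<phi> l f) = 0}"
      using dep0[of a] q(3) by (simp add: \<phi>_def)
  qed
  ultimately have dep: "(\<Sum>l<j. \<phi> l f) = 0" if "f \<in> L" for f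
    using fvs.span_minimal B(3) that by blast
  \<comment> \<open>Chord 0 is left out: only \<open>k - 1\<close> conditions are imposed, which
    gains the one dimension required.\<close>
  define K where "K = {f \<in> L. \<forall>i\<in>{1..<k}. \<phi> i f = 0}"
  have "N \<le> card {1..<k} + fvs.dim K"
    unfolding K_def assms(6)[symmetric]
    by (rule dim_kernel_functionals[OF assms(4) B(3) \<open>finite B\<close>]) (auto simp: \<phi>_add \<phi>_scale)
  then have dimK: "N - k < fvs.dim K"
    using assms(1,2) by simp
  have K: "K \<subseteq> cond_alg k q"
  proof
    fix f assume f: "f \<in> K"
    have pos: "\<phi> i f = 0" if "0 < i" "i < k" for i
      using f that by (auto simp: K_def)
    \<comment> \<open>In the linear relation on \<open>L\<close> all terms but that of chord 0
      vanish on \<open>K\<close>, so its condition comes for free.\<close>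
    have "(\<Sum>l<j. \<phi> l f) = (\<Sum>l\<in>{0}. \<phi> l f)"
      using pos j(1) jk by (intro sum.mono_neutral_right) auto
    then have "\<phi> 0 f = 0"
      using dep f by (simp add: K_def)
    then have "\<phi> i f = 0" if "i < k" for i
      using pos[of i] that by (cases "i = 0") auto
    then show "f \<in> cond_alg k q"
      using f assms(5) by (auto simp: cond_alg_def K_def \<phi>_def)
  qed
  define A where "A = limit_alg k 1 (\<lambda>_. q)"
  have "in_config k q"
    unfolding in_config_def using same_pt_S1_fundamental_domain q(1,2)
    by (metis inj_eq rangeI subsetD)
  then have "equilevel_algebra k A"
    unfolding equilevel_algebra_def A_def using algebraic_germ_const by blast
  \<comment> \<open>Monotonicity of \<open>dim\<close> relies on a finite basis of the larger space,
    obtained from the finite spanning set \<open>B\<close> of \<open>L\<close>.\<close>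
  moreover have "fvs.dim K \<le> fvs.dim (A \<inter> L)"
  proof -
    obtain C where C: "C \<subseteq> A \<inter> L" "fvs.independent C" "A \<inter> L \<subseteq> fvs.span C" "card C = fvs.dim (A \<inter> L)"
      by (rule fvs.basis_exists)
    have "finite C"
      using fvs.independent_span_bound[OF \<open>finite B\<close> C(2)] C(1) B(3) by blast
    moreover have "K \<subseteq> A \<inter> L"
      using K cond_alg_subset_limit_alg_const by (auto simp: A_def K_def)
    ultimately show ?thesis
      using fvs.dim_le_card[of K C] C(3,4) by auto
  qed
  ultimately show ?thesis
    using dimK by (meson less_le_trans)
qed

end
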